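(* Let $\nu$ be fixed and let problem (P)$^\nu$, its minimum value $\mathfrak{m}^\nu$, the function $\psi_0$, and the outer approximation algorithm be as defined in the context. Suppose that $X\subset\mathbb{R}^n$, $Y\subset\mathbb{R}^m$, $D\subset\mathbb{R}^q$ are nonempty closed sets, $Y^\nu\subset Y$ is nonempty and compact, $g^\nu:\mathbb{R}^n\times\mathbb{R}^m\to\mathbb{R}$ and $H^\nu:\mathbb{R}^n\times\mathbb{R}^m\to\mathbb{R}^q$ are continuous, $f^\nu:\mathbb{R}^n\times\mathbb{R}^m\to(-\infty,\infty]$ is continuous relative to $\operatorname{dom}f^\nu$, $\operatorname{dom}f^\nu$ is closed, and for each $\bar x\in X$ and $\epsilon\in(0,\infty)$ there is $\rho\in(0,\infty)$ such that for all $z\in Y^\nu$ and all $x\in X$ with $\|x-\bar x\|_2\le\rho$, $$|g^\nu(x,z)-g^\nu(\bar x,z)|\le\epsilon,\qquad \|H^\nu(x,z)-H^\nu(\bar x,z)\|\le\epsilon.$$ If the outer approximation algorithm generates $(x^k,y^k,u^k,\alpha^k,\lambda^k)$, $k\in\mathbb{N}$, using tolerances $\epsilon^k\to0$ and $\delta^k\to0$, and $$(x^k,y^k,u^k,\alpha^k,\lambda^k)\to(\hat x,\hat y,\hat u,\hat\alpha,\hat\lambda)\quad\text{along } k\in N$$ for some subsequence $N\subset\mathbb{N}$, then $(\hat x,\hat y,\hat u,\hat\alpha,\hat\lambda)$ is an optimal solution of (P)$^\nu$ and $$\psi_0(x^k,y^k,u^k,\alpha^k,\lambda^k)\to\mathfrak{m}^\nu\quad\text{along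 } k\in N.$$
   Context: Fix an arbitrary norm $\|\cdot\|$ on $\mathbb{R}^q$; $\operatorname{dist}(a,D)=\inf_{a'\in D}\|a-a'\|$. $\operatorname{dom}f^\nu=\{(x,y)\mid f^\nu(x,y)<\infty\}$. For a function $\psi$, a set $Z$ and $\epsilon\in[0,\infty)$, $\epsilon\text{-}\operatorname{argmin}_{z\in Z}\psi(z)=\{\bar z\in Z\mid\psi(\bar z)\le\inf_{z\in Z}\psi(z)+\epsilon,\ \psi(\bar z)<\infty\}$. A function is continuous relative to a set $C$ if $\psi(w^k)\to\psi(w)$ whenever $w^k\in C\to w\in C$. A subsequence $N\subset\mathbb{N}$ is an infinite subset of indices. Problem (P)$^\nu$, with parameters $\sigma^\nu,\theta^\nu,\bar\lambda^\nu,\tau^\nu\in[0,\infty)$: minimize $f^\nu(x,y)+\sigma^\nu\|u\|-\theta^\nu\alpha$ over $(x,y,u,\alpha,\lambda)$ subject to $H^\nu(x,y)+u\in D$; $\;g^\nu(x,y)+\alpha\le g^\nu(x,z)+\lambda\operatorname{dist}(H^\nu(x,z),D)+\tau^\nu$ for all $z\in Y^\nu$; $\;x\in X$, $y\in Y$, $u\in\mathbb{R}^q$, $\alpha\in(-\infty,0]$, $\lambda\in[0,\bar\lambda^\nu]$. $\mathfrak{m}^\nu$ is the infimum of the objective over points satisfying these constraints ($\infty$ if none); an optimal solution is a point satisfying the constraints with finite objective value at most $\mathfrak{m}^\nu$. Notation: $C=\{(x,y,u,\alpha,\lambda)\in\mathbb{R}^{n+m+q+2}\mid x\in X,\ y\in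 Y,\ \alpha\le0,\ \lambda\in[0,\bar\lambda^\nu],\ H^\nu(x,y)+u\in D,\ (x,y)\in\operatorname{dom}f^\nu\}$; $\psi_0(x,y,u,\alpha,\lambda)=f^\nu(x,y)+\sigma^\nu\|u\|-\theta^\nu\alpha$; $\psi_z(x,y,u,\alpha,\lambda)=g^\nu(x,y)+\alpha-g^\nu(x,z)-\lambda\operatorname{dist}(H^\nu(x,z),D)-\tau^\nu$ for $z\in Y^\nu$. Outer approximation algorithm. Data: $(x^0,y^0,u^0,\alpha^0,\lambda^0)\in C$, $Y^\nu_0=\emptyset$, and tolerances $\epsilon^k,\delta^k\ge0$, $k\in\mathbb{N}$. For $k=1,2,\dots$: Step 1: set $Y^\nu_k=Y^\nu_{k-1}\cup\{z^k\}$, where $z^k\in\delta^k\text{-}\operatorname{argmin}_{z\in Y^\nu}\big\{g^\nu(x^{k-1},z)+\lambda^{k-1}\operatorname{dist}(H^\nu(x^{k-1},z),D)\big\}$. Step 2: compute $(x^k,y^k,u^k,\alpha^k,\lambda^k)\in\epsilon^k\text{-}\operatorname{argmin}_{w\in C}\{\psi_0(w)\mid\psi_z(w)\le0,\ z\in Y^\nu_k\}$. *)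

theory Defs
  imports "HOL-Analysis.Analysis"
begin

text \<open>The library fixes one norm per type. An arbitrary norm on the Euclidean space is therefore
  carried as an explicit function \<open>N\<close>; \<^const>\<open>norm\<close> remains the Euclidean norm.\<close>

definition is_norm :: "('v::real_vector \<Rightarrow> real) \<Rightarrow> bool" where
  "is_norm N \<longleftrightarrow>
     (\<forall>v. 0 \<le> N v) \<and> (\<forall>v. N v = 0 \<longleftrightarrow> v = 0) \<and>
     (\<forall>c v. N (c *\<^sub>R v) = \<bar>c\<bar> * N v) \<and> (\<forall>v w. N (v + w) \<le> N v + N w)"

definition set_dist :: "('v::real_vector \<Rightarrow> real) \<Rightarrow> 'v \<Rightarrow> 'v set \<Rightarrow> real" where
  "set_dist N a D = (INF a'\<in>D. N (a - a'))"

definition effdom :: "('v \<Rightarrow> ereal) \<Rightarrow> 'v set" where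
  "effdom f = {p. f p < \<infinity>}"

definition eps_argmin :: "real \<Rightarrow> 'v set \<Rightarrow> ('v \<Rightarrow> ereal) \<Rightarrow> 'v set" where
  "eps_argmin \<epsilon> Z \<psi> = {z\<in>Z. \<psi> z \<le> (INF z'\<in>Z. \<psi> z') + ereal \<epsilon> \<and> \<psi> z < \<infinity>}"

text \<open>Convergence along an infinite index set \<open>K\<close> is convergence with respect to this filter.\<close>

abbreviation along :: "nat set \<Rightarrow> nat filter" where
  "along K \<equiv> inf sequentially (principal K)"

text \<open>Points \<open>(x, y, u, \<alpha>, \<lambda>)\<close>; the last component is written \<open>l\<close> below.\<close>

type_synonym ('n, 'm, 'q) point = "(real^'n) \<times> (real^'m) \<times> (real^'q) \<times> real \<times> real"

definition psi0 ::
  "(real^'q \<Rightarrow> real) \<Rightarrow> ((real^'n) \<times> (real^'m) \<Rightarrow> ereal) \<Rightarrow> real \<Rightarrow> real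
    \<Rightarrow> ('n::finite, 'm::finite, 'q::finite) point \<Rightarrow> ereal" where
  "psi0 N f \<sigma> \<theta> = (\<lambda>(x, y, u, \<alpha>, l). f (x, y) + ereal (\<sigma> * N u) - ereal (\<theta> * \<alpha>))"

definition psi ::
  "(real^'q \<Rightarrow> real) \<Rightarrow> (real^'q) set \<Rightarrow> ((real^'n) \<times> (real^'m) \<Rightarrow> real)
    \<Rightarrow> ((real^'n) \<times> (real^'m) \<Rightarrow> real^'q) \<Rightarrow> real
    \<Rightarrow> real^'m \<Rightarrow> ('n::finite, 'm::finite, 'q::finite) point \<Rightarrow> real" where
  "psi N D g H \<tau> z =
     (\<lambda>(x, y, u, \<alpha>, l). g (x, y) + \<alpha> - g (x, z) - l * set_dist N (H (x, z)) D - \<tau>)"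

definition feasible ::
  "(real^'q \<Rightarrow> real) \<Rightarrow> (real^'n) set \<Rightarrow> (real^'m) set \<Rightarrow> (real^'m) set \<Rightarrow> (real^'q) set
    \<Rightarrow> ((real^'n) \<times> (real^'m) \<Rightarrow> real) \<Rightarrow> ((real^'n) \<times> (real^'m) \<Rightarrow> real^'q) \<Rightarrow> real \<Rightarrow> real
    \<Rightarrow> ('n::finite, 'm::finite, 'q::finite) point set" where
  "feasible N X Y Yn D g H lbar \<tau> = {(x, y, u, \<alpha>, l).
     H (x, y) + u \<in> D \<and>
     (\<forall>z\<in>Yn. g (x, y) + \<alpha> \<le> g (x, z) + l * set_dist N (H (x, z)) D + \<tau>) \<and>
     x \<in> X \<and> y \<in> Y \<and> \<alpha> \<le> 0 \<and> 0 \<le> l \<and> l \<le> lbar}"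

definition min_value :: "'v set \<Rightarrow> ('v \<Rightarrow> ereal) \<Rightarrow> ereal" where
  "min_value F \<phi> = (INF w\<in>F. \<phi> w)"

definition optimal_solution :: "'v set \<Rightarrow> ('v \<Rightarrow> ereal) \<Rightarrow> 'v \<Rightarrow> bool" where
  "optimal_solution F \<phi> w \<longleftrightarrow> w \<in> F \<and> \<bar>\<phi> w\<bar> \<noteq> \<infinity> \<and> \<phi> w \<le> min_value F \<phi>"

definition C_set ::
  "(real^'n) set \<Rightarrow> (real^'m) set \<Rightarrow> (real^'q) set \<Rightarrow> ((real^'n) \<times> (real^'m) \<Rightarrow> ereal)
    \<Rightarrow> ((real^'n) \<times> (real^'m) \<Rightarrow> real^'q) \<Rightarrow> real
    \<Rightarrow> ('n::finite, 'm::finite, 'q::finite) point set" where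
  "C_set X Y D f H lbar = {(x, y, u, \<alpha>, l).
     x \<in> X \<and> y \<in> Y \<and> \<alpha> \<le> 0 \<and> 0 \<le> l \<and> l \<le> lbar \<and> H (x, y) + u \<in> D \<and> (x, y) \<in> effdom f}"

text \<open>\<open>w\<close>, \<open>z\<close>, \<open>Yk\<close> form a run of the outer approximation algorithm with tolerances
  \<open>\<epsilon>\<close>, \<open>\<delta>\<close>. The values of \<open>z\<close>, \<open>\<epsilon>\<close>, \<open>\<delta>\<close> at index \<open>0\<close> are irrelevant.\<close>

definition outer_approx_run ::
  "(real^'q \<Rightarrow> real) \<Rightarrow> (real^'n) set \<Rightarrow> (real^'m) set \<Rightarrow> (real^'m) set \<Rightarrow> (real^'q) set
    \<Rightarrow> ((real^'n) \<times> (real^'m) \<Rightarrow> ereal) \<Rightarrow> ((real^'n) \<times> (real^'m) \<Rightarrow> real)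
    \<Rightarrow> ((real^'n) \<times> (real^'m) \<Rightarrow> real^'q) \<Rightarrow> real \<Rightarrow> real \<Rightarrow> real \<Rightarrow> real
    \<Rightarrow> (nat \<Rightarrow> real) \<Rightarrow> (nat \<Rightarrow> real)
    \<Rightarrow> (nat \<Rightarrow> real^'m) \<Rightarrow> (nat \<Rightarrow> (real^'m) set)
    \<Rightarrow> (nat \<Rightarrow> ('n::finite, 'm::finite, 'q::finite) point) \<Rightarrow> bool" where
  "outer_approx_run N X Y Yn D f g H \<sigma> \<theta> lbar \<tau> \<epsilon> \<delta> z Yk w \<longleftrightarrow>
     w 0 \<in> C_set X Y D f H lbar \<and> Yk 0 = {} \<and>
     (\<forall>k\<ge>1.
        (case w (k - 1) of (x, y, u, \<alpha>, l) \<Rightarrow>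
           z k \<in> eps_argmin (\<delta> k) Yn
                   (\<lambda>z'. ereal (g (x, z') + l * set_dist N (H (x, z')) D))) \<and>
        Yk k = Yk (k - 1) \<union> {z k} \<and>
        w k \<in> eps_argmin (\<epsilon> k)
                {v \<in> C_set X Y D f H lbar. \<forall>z'\<in>Yk k. psi N D g H \<tau> z' v \<le> 0}
                (psi0 N f \<sigma> \<theta>))"

end

theory Submission
  imports Defs
begin

text \<open>The cut added after step \<open>k \<in> K\<close> stays in force for every later iterate, so by continuity it
  holds at the limit; because that cut is the most violated one at \<open>w k\<close> up to \<open>\<delta> (Suc k)\<close>, and the
  constraint functions are continuous uniformly over the compact index set, letting \<open>k\<close> grow along \<open>K\<close>
  yields all constraints at the limit. The subproblems are relaxations, so the values of \<open>psi0\<close> along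
  the run exceed the minimum value by at most \<open>\<epsilon> k\<close>.\<close>

lemma is_norm_minus_commute:
  assumes "is_norm N"
  shows "N (a - b) = N (b - a)"
proof -
  have "N ((- 1) *\<^sub>R (b - a)) = \<bar>- 1\<bar> * N (b - a)"
    using assms unfolding is_norm_def by blast
  then show ?thesis by simp
qed

text \<open>Homogeneity and the triangle inequality make \<open>N\<close> convex, and a convex
  function on a finite-dimensional space is continuous.\<close>

lemma is_norm_continuous_on:
  fixes N :: "'v::euclidean_space \<Rightarrow> real"
  assumes "is_norm N"
  shows "continuous_on UNIV N"
proof (rule convex_on_continuous)
  show "convex_on UNIV N"
  proof (rule convex_onI)
    fix t :: real and x y :: 'v
    assume t: "0 < t" "t < 1"
    have "N ((1 - t) *\<^sub>R x + t *\<^sub>R y) \<le> N ((1 - t) *\<^sub>R x) + N (t *\<^sub>R y)"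
      using assms unfolding is_norm_def by blast
    moreover have "N ((1 - t) *\<^sub>R x) = \<bar>1 - t\<bar> * N x" "N (t *\<^sub>R y) = \<bar>t\<bar> * N y"
      using assms unfolding is_norm_def by blast+
    ultimately show "N ((1 - t) *\<^sub>R x + t *\<^sub>R y) \<le> (1 - t) * N x + t * N y"
      using t by simp
  qed simp
qed simp

lemma set_dist_le_add:
  assumes N: "is_norm N" and "D \<noteq> {}"
  shows "set_dist N a D \<le> set_dist N b D + N (a - b)"
proof -
  have "set_dist N a D - N (a - b) \<le> (INF d\<in>D. N (b - d))"
  proof (rule cINF_greatest[OF \<open>D \<noteq> {}\<close>])
    fix d assume "d \<in> D"
    \<comment> \<open>A real infimum is a lower bound only for a family bounded below; here 0 bounds
      it.\<close>
    have "bdd_below ((\<lambda>d. N (a - d)) ` D)"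
      using N unfolding is_norm_def by (intro bdd_belowI[of _ 0]) auto
    then have "set_dist N a D \<le> N (a - d)"
      unfolding set_dist_def using \<open>d \<in> D\<close> by (rule cINF_lower)
    moreover have "N ((a - b) + (b - d)) \<le> N (a - b) + N (b - d)"
      using N unfolding is_norm_def by blast
    ultimately show "set_dist N a D - N (a - b) \<le> N (b - d)" by simp
  qed
  then show ?thesis by (simp add: set_dist_def)
qed

text \<open>The distance is 1-Lipschitz with respect to \<open>N\<close>, and \<open>N\<close>
  itself is continuous and vanishes at 0.\<close>

lemma set_dist_continuous_on:
  fixes N :: "'v::euclidean_space \<Rightarrow> real"
  assumes N: "is_norm N" and "D \<noteq> {}"
  shows "continuous_on UNIV (\<lambda>a. set_dist N a D)"
proof -
  have "((\<lambda>a. set_dist N a D) \<longlongrightarrow> set_dist N b D) (at b)" for b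
  proof (rule LIM_zero_cancel, rule Lim_null_comparison)
    show "\<forall>\<^sub>F a in at b. norm (set_dist N a D - set_dist N b D) \<le> N (a - b)"
      using set_dist_le_add[OF assms] is_norm_minus_commute[OF N]
      by (intro always_eventually allI) (smt (verit) real_norm_def)
    have "continuous_on UNIV (\<lambda>a. N (a - b))"
      by (intro continuous_on_compose2[OF is_norm_continuous_on[OF N]] continuous_intros) auto
    then have "((\<lambda>a. N (a - b)) \<longlongrightarrow> N (b - b)) (at b)"
      unfolding continuous_on_def by (rule bspec) simp
    then show "((\<lambda>a. N (a - b)) \<longlongrightarrow> 0) (at b)"
      using N unfolding is_norm_def by (metis diff_self)
  qed
  then show ?thesis by (simp add: continuous_on_def)
qed

text \<open>An infinite index set meets every tail. Nontriviality of the filter lets inequalities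
  pass to limits and yields a concrete index from an eventual property.\<close>

lemma along_neq_bot: "infinite K \<Longrightarrow> along K \<noteq> bot"
  unfolding trivial_limit_def eventually_inf_principal eventually_sequentially infinite_nat_iff_unbounded_le
  by blast

lemma along_eventually_mem: "\<forall>\<^sub>F k in along K. k \<in> K \<and> n \<le> k"
  by (auto simp: eventually_inf_principal eventually_sequentially)

text \<open>Abstract form of the cut argument: the constraint indexed by \<open>t\<close> reads
  \<open>a v \<le> h (v, t)\<close>, with all dependence on \<open>t\<close> in \<open>h\<close>.
  The shift in \<open>z (Suc k)\<close> reflects that this cut is chosen at \<open>w k\<close> and
  binds the iterates from \<open>Suc k\<close> on.\<close>

lemma outer_approx_limit_cuts:
  fixes a :: "'p::metric_space \<Rightarrow> real" and h :: "'p \<times> 'z::metric_space \<Rightarrow> real"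
  assumes a: "continuous_on UNIV a" and h: "continuous_on UNIV h" and "compact Z"
    and zZ: "\<And>k. z (Suc k) \<in> Z"
    and near_min: "\<And>k t. t \<in> Z \<Longrightarrow> h (w k, z (Suc k)) \<le> h (w k, t) + \<delta> (Suc k)"
    and cut: "\<And>j k. k < j \<Longrightarrow> a (w j) \<le> h (w j, z (Suc k))"
    and "\<delta> \<longlonglongrightarrow> 0" and "infinite K" and w: "(w \<longlongrightarrow> v) (along K)"
    and "t \<in> Z"
  shows "a v \<le> h (v, t)"
proof (rule field_le_epsilon)
  fix e :: real assume "0 < e"
  note nb = along_neq_bot[OF \<open>infinite K\<close>]
  have h_lim: "((\<lambda>j. h (w j, s)) \<longlongrightarrow> h (v, s)) (along K)" for s
    by (rule continuous_on_tendsto_compose[OF h]) (auto intro!: tendsto_intros w)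
  have a_lim: "((\<lambda>j. a (w j)) \<longlongrightarrow> a v) (along K)"
    by (rule continuous_on_tendsto_compose[OF a w]) auto
  \<comment> \<open>Here \<open>k\<close> is fixed, inside or outside \<open>K\<close>, and only
    \<open>j\<close> grows along \<open>K\<close>.\<close>
  have limit_cut: "a v \<le> h (v, z (Suc k))" for k
    by (rule tendsto_le[OF nb h_lim a_lim])
       (use along_eventually_mem[of K "Suc k"] in eventually_elim, auto intro: cut)
  have "0 < e / 3" using \<open>0 < e\<close> by simp
  \<comment> \<open>The point \<open>z (Suc k)\<close> moves with \<open>k\<close>, so one
    neighbourhood of \<open>v\<close> must serve all \<open>s \<in> Z\<close>; compactness of
    \<open>Z\<close> provides it.\<close>
  obtain U where U: "v \<in> U" "open U"
      "\<And>x s. x \<in> U \<Longrightarrow> s \<in> Z \<Longrightarrow> dist (h (x, s)) (h (v, s)) \<le> e / 3"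
    using continuous_on_prod_compactE[OF continuous_on_subset[OF h subset_UNIV] \<open>compact Z\<close> UNIV_I \<open>0 < e / 3\<close>, of v]
    by (metis Int_UNIV_right)
  have "(\<lambda>k. \<delta> (Suc k)) \<longlonglongrightarrow> 0"
    using \<open>\<delta> \<longlonglongrightarrow> 0\<close> by (rule LIMSEQ_Suc)
  then have "((\<lambda>k. \<delta> (Suc k)) \<longlongrightarrow> 0) (along K)"
    by (rule tendsto_mono[rotated]) simp
  then have "\<forall>\<^sub>F k in along K. \<delta> (Suc k) < e / 3"
    using \<open>0 < e / 3\<close> by (rule order_tendstoD)
  moreover have "\<forall>\<^sub>F k in along K. w k \<in> U"
    using w U(2,1) by (rule topological_tendstoD)
  ultimately have "\<forall>\<^sub>F k in along K. \<delta> (Suc k) < e / 3 \<and> w k \<in> U"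
    by (rule eventually_conj)
  then obtain k where k: "\<delta> (Suc k) < e / 3" "w k \<in> U"
    using nb by (auto dest: eventually_happens')
  \<comment> \<open>A single index suffices. The three errors of \<open>e / 3\<close> come from
    moving \<open>v\<close> to \<open>w k\<close>, from near-minimality at \<open>w k\<close>, and
    from moving back to \<open>v\<close>.\<close>
  have "a v \<le> h (v, z (Suc k))" by (rule limit_cut)
  also have "\<dots> \<le> h (w k, z (Suc k)) + e / 3"
    using U(3)[OF k(2) zZ[of k]] unfolding dist_real_def by linarith
  also have "\<dots> \<le> h (w k, t) + 2 * e / 3"
    using near_min[OF \<open>t \<in> Z\<close>, of k] k(1) by simp
  also have "\<dots> \<le> h (v, t) + e"
    using U(3)[OF k(2) \<open>t \<in> Z\<close>] unfolding dist_real_def by linarith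
  finally show "a v \<le> h (v, t) + e" .
qed

lemma eps_argmin_memD:
  assumes "p \<in> eps_argmin e Z \<phi>" and "q \<in> Z"
  shows "\<phi> p \<le> \<phi> q + ereal e"
proof -
  have "\<phi> p \<le> (INF q\<in>Z. \<phi> q) + ereal e"
    using assms(1) by (simp add: eps_argmin_def)
  also have "\<dots> \<le> \<phi> q + ereal e"
    using assms(2) by (intro add_right_mono INF_lower)
  finally show ?thesis .
qed

lemma closed_C_set:
  assumes "closed X" "closed Y" "closed D" "continuous_on UNIV H" "closed (effdom f)"
  shows "closed (C_set X Y D f H lbar)"
proof -
  \<comment> \<open>With projections in place of the tuple pattern, each condition is a preimage of
    a closed set under a continuous map or a weak inequality between continuous functions.\<close>
  have eq: "C_set X Y D f H lbar =
      {v. fst v \<in> X} \<inter> {v. fst (snd v) \<in> Y} \<inter> {v. H (fst v, fst (snd v)) + fst (snd (snd v)) \<in> D} \<inter>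
      {v. (fst v, fst (snd v)) \<in> effdom f} \<inter>
      {v. fst (snd (snd (snd v))) \<le> 0 \<and> 0 \<le> snd (snd (snd (snd v))) \<and> snd (snd (snd (snd v))) \<le> lbar}"
    by (auto simp: C_set_def)
  have H: "continuous_on UNIV (\<lambda>v. H (fst v, fst (snd v)) + fst (snd (snd v)))"
    by (intro continuous_intros continuous_on_compose2[OF assms(4)]) auto
  show ?thesis
    unfolding eq
    by (intro closed_Int closed_Collect_conj closed_Collect_le continuous_intros
        closed_vimage[unfolded vimage_def] assms H)
qed

theorem proposition4p2:
  fixes N :: "real^'q \<Rightarrow> real"
    and X :: "(real^'n) set" and Y Yn :: "(real^'m) set" and D :: "(real^'q) set"
    and f :: "(real^'n) \<times> (real^'m) \<Rightarrow> ereal"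
    and g :: "(real^'n) \<times> (real^'m) \<Rightarrow> real"
    and H :: "(real^'n) \<times> (real^'m) \<Rightarrow> real^'q"
    and \<sigma> \<theta> lbar \<tau> :: real
    and \<epsilon> \<delta> :: "nat \<Rightarrow> real"
    and z :: "nat \<Rightarrow> real^'m" and Yk :: "nat \<Rightarrow> (real^'m) set"
    and w :: "nat \<Rightarrow> ('n::finite, 'm::finite, 'q::finite) point"
    and w_hat :: "('n, 'm, 'q) point"
    and K :: "nat set"
  assumes "is_norm N"
    and "0 \<le> \<sigma>" "0 \<le> \<theta>" "0 \<le> lbar" "0 \<le> \<tau>"
    and "X \<noteq> {}" "closed X" "Y \<noteq> {}" "closed Y" "D \<noteq> {}" "closed D"
    and "Yn \<subseteq> Y" "Yn \<noteq> {}" "compact Yn"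
    and "continuous_on UNIV g" "continuous_on UNIV H"
    and "\<forall>p. f p \<noteq> -\<infinity>" "continuous_on (effdom f) f" "closed (effdom f)"
    and "\<forall>xbar\<in>X. \<forall>e>0. \<exists>\<rho>>0. \<forall>y\<in>Yn. \<forall>x\<in>X. norm (x - xbar) \<le> \<rho> \<longrightarrow>
           \<bar>g (x, y) - g (xbar, y)\<bar> \<le> e \<and> N (H (x, y) - H (xbar, y)) \<le> e"
    and "\<forall>k\<ge>1. 0 \<le> \<epsilon> k" "\<forall>k\<ge>1. 0 \<le> \<delta> k"
    and "\<epsilon> \<longlonglongrightarrow> 0" "\<delta> \<longlonglongrightarrow> 0"
    and "outer_approx_run N X Y Yn D f g H \<sigma> \<theta> lbar \<tau> \<epsilon> \<delta> z Yk w"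
    and "infinite K" "(w \<longlongrightarrow> w_hat) (along K)"
  shows "optimal_solution (feasible N X Y Yn D g H lbar \<tau>) (psi0 N f \<sigma> \<theta>) w_hat \<and>
         ((\<lambda>k. psi0 N f \<sigma> \<theta> (w k)) \<longlongrightarrow>
            min_value (feasible N X Y Yn D g H lbar \<tau>) (psi0 N f \<sigma> \<theta>)) (along K)"
proof -
  define C :: "('n, 'm, 'q) point set" where "C = C_set X Y D f H lbar"
  define F :: "('n, 'm, 'q) point set" where "F = feasible N X Y Yn D g H lbar \<tau>"
  define \<phi> :: "('n, 'm, 'q) point \<Rightarrow> ereal" where "\<phi> = psi0 N f \<sigma> \<theta>"
  \<comment> \<open>\<open>a\<close> collects the terms of \<open>psi\<close> free of
    \<open>z\<close>, including \<open>\<tau>\<close>; \<open>h\<close> is the objective minimized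
    in Step 1.\<close>
  define a :: "('n, 'm, 'q) point \<Rightarrow> real"
    where "a = (\<lambda>v. g (fst v, fst (snd v)) + fst (snd (snd (snd v))) - \<tau>)"
  define h :: "('n, 'm, 'q) point \<times> (real^'m) \<Rightarrow> real"
    where "h = (\<lambda>p. g (fst (fst p), snd p)
                 + snd (snd (snd (snd (fst p)))) * set_dist N (H (fst (fst p), snd p)) D)"
  note N = \<open>is_norm N\<close> and run = assms(25)[unfolded outer_approx_run_def]
  note nb = along_neq_bot[OF \<open>infinite K\<close>]
  have psi_eq: "psi N D g H \<tau> t v = a v - h (v, t)" for t v
    by (simp add: psi_def a_def h_def split: prod.splits)
  \<comment> \<open>\<open>C\<close> requires finiteness of \<open>f\<close> from above while
    \<open>F\<close> does not, hence the domain condition on the left.\<close>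
  have feasible_iff: "v \<in> F \<and> (fst v, fst (snd v)) \<in> effdom f \<longleftrightarrow> v \<in> C \<and> (\<forall>t\<in>Yn. a v \<le> h (v, t))" for v
    by (cases v) (auto simp: F_def C_def feasible_def C_set_def a_def h_def algebra_simps)
  have z_argmin: "z (Suc k) \<in> eps_argmin (\<delta> (Suc k)) Yn (\<lambda>t. ereal (h (w k, t)))" for k
    using run by (cases "w k") (auto simp: h_def dest!: spec[of _ "Suc k"])
  have Yk_Suc: "Yk (Suc k) = insert (z (Suc k)) (Yk k)" for k
    using run by (auto dest!: spec[of _ "Suc k"])
  have w_argmin: "w (Suc k) \<in> eps_argmin (\<epsilon> (Suc k)) {v \<in> C. \<forall>t\<in>Yk (Suc k). a v \<le> h (v, t)} \<phi>" for k
    using run by (auto simp: psi_eq C_def \<phi>_def dest!: spec[of _ "Suc k"])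
  have zY: "z (Suc k) \<in> Yn" for k
    using z_argmin by (auto simp: eps_argmin_def)
  have Yk_sub: "Yk k \<subseteq> Yn" for k
    by (induction k) (use run zY in \<open>auto simp: Yk_Suc\<close>)
  have z_mem: "z (Suc k) \<in> Yk j" if "k < j" for j k
    using that by (induction j) (auto simp: Yk_Suc less_Suc_eq)
  \<comment> \<open>Index 0 is covered by the initial data, later indices by Step 2.\<close>
  have wC: "w k \<in> C" for k
    using run w_argmin by (cases k) (auto simp: C_def eps_argmin_def)
  have a_cont: "continuous_on UNIV a"
    unfolding a_def
    by (intro continuous_intros continuous_on_compose2[OF \<open>continuous_on UNIV g\<close>]) auto
  have h_cont: "continuous_on UNIV h"
    unfolding h_def
    by (intro continuous_intros continuous_on_compose2[OF \<open>continuous_on UNIV g\<close>]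
        continuous_on_compose2[OF set_dist_continuous_on[OF N \<open>D \<noteq> {}\<close>]]
        continuous_on_compose2[OF \<open>continuous_on UNIV H\<close>]) auto

  have "closed C"
    unfolding C_def using assms by (intro closed_C_set)
  then have hatC: "w_hat \<in> C"
    by (rule Lim_in_closed_set[OF _ always_eventually nb assms(27)]) (simp add: wC)
  have "a w_hat \<le> h (w_hat, t)" if "t \<in> Yn" for t
  proof (rule outer_approx_limit_cuts[where z = z, OF a_cont h_cont \<open>compact Yn\<close> zY _ _ \<open>\<delta> \<longlonglongrightarrow> 0\<close> \<open>infinite K\<close>
        assms(27) that])
    show "h (w k, z (Suc k)) \<le> h (w k, s) + \<delta> (Suc k)" if "s \<in> Yn" for k s
      using eps_argmin_memD[OF z_argmin that] by simp
    \<comment> \<open>Since \<open>j\<close> is positive, \<open>w j\<close> solves a subproblem,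
      and its index set \<open>Yk j\<close> still contains \<open>z (Suc k)\<close>.\<close>
    show "a (w j) \<le> h (w j, z (Suc k))" if "k < j" for j k
      using that w_argmin[of "j - 1"] z_mem[OF that] by (auto simp: eps_argmin_def)
  qed
  then have hatF: "w_hat \<in> F" and hat_dom: "(fst w_hat, fst (snd w_hat)) \<in> effdom f"
    using feasible_iff hatC by blast+
  then have min_le: "min_value F \<phi> \<le> \<phi> w_hat"
    unfolding min_value_def by (intro INF_lower)

  \<comment> \<open>Merging the real terms leaves a single extended-real summand, so no sum of
    opposite infinities can arise.\<close>
  have \<phi>_eq: "\<phi> v = f (fst v, fst (snd v))
      + ereal (\<sigma> * N (fst (snd (snd v))) - \<theta> * fst (snd (snd (snd v))))" for v
    by (cases v; cases "f (fst v, fst (snd v))") (auto simp: \<phi>_def psi0_def)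
  have "\<bar>f (fst w_hat, fst (snd w_hat))\<bar> \<noteq> \<infinity>"
    using hat_dom assms(17) by (auto simp: effdom_def)
  then have finite: "\<bar>\<phi> w_hat\<bar> \<noteq> \<infinity>"
    by (auto simp: \<phi>_eq)

  \<comment> \<open>Continuity of \<open>f\<close> relative to its domain is enough, because all
    iterates and the limit lie over that domain.\<close>
  have "((\<lambda>k. f (fst (w k), fst (snd (w k)))) \<longlongrightarrow> f (fst w_hat, fst (snd w_hat))) (along K)"
  proof (rule continuous_on_tendsto_compose[OF assms(18) _ hat_dom])
    show "\<forall>\<^sub>F k in along K. (fst (w k), fst (snd (w k))) \<in> effdom f"
      using wC by (intro always_eventually allI) (simp add: C_def C_set_def split_beta)
  qed (intro tendsto_intros assms(27))
  moreover have "((\<lambda>k. N (fst (snd (snd (w k))))) \<longlongrightarrow> N (fst (snd (snd w_hat)))) (along K)"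
    by (rule continuous_on_tendsto_compose[OF is_norm_continuous_on[OF N]])
       (auto intro!: tendsto_intros assms(27))
  ultimately have \<phi>_lim: "((\<lambda>k. \<phi> (w k)) \<longlongrightarrow> \<phi> w_hat) (along K)"
    unfolding \<phi>_eq using \<open>\<bar>f (fst w_hat, fst (snd w_hat))\<bar> \<noteq> \<infinity>\<close>
    by (intro tendsto_add_ereal_general tendsto_intros assms(27)) auto

  have "\<phi> w_hat \<le> \<phi> v" if "v \<in> F" for v
  \<comment> \<open>Off the domain the objective is infinite. On it, \<open>v\<close> satisfies the
    cuts for all of \<open>Yn\<close>, hence those in \<open>Yk k\<close>, and competes in every
    subproblem.\<close>
  proof (cases "(fst v, fst (snd v)) \<in> effdom f")
    case False
    then show ?thesis by (simp add: \<phi>_eq effdom_def)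
  next
    case True
    have bound: "\<phi> (w k) \<le> \<phi> v + ereal (\<epsilon> k)" if "1 \<le> k" for k
    proof -
      have "v \<in> {v \<in> C. \<forall>t\<in>Yk k. a v \<le> h (v, t)}"
        using feasible_iff[of v] \<open>v \<in> F\<close> True Yk_sub by blast
      then show ?thesis
        using eps_argmin_memD w_argmin[of "k - 1"] that by fastforce
    qed
    have "(\<epsilon> \<longlongrightarrow> 0) (along K)"
      using \<open>\<epsilon> \<longlonglongrightarrow> 0\<close> by (rule tendsto_mono[rotated]) simp
    then have lim: "((\<lambda>k. \<phi> v + ereal (\<epsilon> k)) \<longlongrightarrow> \<phi> v + ereal 0) (along K)"
      by (intro tendsto_add_ereal_general tendsto_intros) auto
    have "\<forall>\<^sub>F k in along K. \<phi> (w k) \<le> \<phi> v + ereal (\<epsilon> k)"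
      using along_eventually_mem[of K 1] by eventually_elim (simp add: bound)
    with tendsto_le[OF nb lim \<phi>_lim] show "\<phi> w_hat \<le> \<phi> v" by simp
  qed
  then have "\<phi> w_hat \<le> min_value F \<phi>"
    unfolding min_value_def by (rule INF_greatest)
  \<comment> \<open>The equality also identifies the limit in \<open>\<phi>_lim\<close> with the
    minimum value.\<close>
  then have "optimal_solution F \<phi> w_hat" "\<phi> w_hat = min_value F \<phi>"
    using hatF finite min_le by (auto simp: optimal_solution_def)
  then show ?thesis
    using \<phi>_lim by (simp add: F_def \<phi>_def)
qed

end
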